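(* Let $k>0$, $r_h>0$ and $\sigma_0\in\mathbb{R}$ be constants. On the region $r>r_h$ with coordinates $(t,r,x,y)$, the metric and scalar field $$\widetilde{ds}^2=k^{-2}\left(-\left(1-\frac{r_h^2}{r^2}\right)dt^2+\frac{dr^2}{r^2\left(1-\frac{r_h^2}{r^2}\right)}+dx^2+dy^2\right),\qquad \sigma=-2\log(kr)-\sigma_0,$$ satisfy $$\widetilde R_{\mu\nu}+\widetilde\nabla_\mu\widetilde\nabla_\nu\sigma=0,\qquad \widetilde R+2\widetilde\Box\sigma-(\tilde\partial\sigma)^2+4k^2=0 .$$ Moreover, in terms of the null coordinates $u,v$ defined in the context, the metric is $$\widetilde{ds}^2=k^{-2}\left(-\frac{du\,dv}{r_h^2-uv}+dx^2+dy^2\right),$$ i.e. its $(u,v)$ part is the two-dimensional Witten black hole metric $-k^{-2}\,du\,dv/(r_h^2-uv)$, and $x,y$ are two flat directions.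
   Context: Signature is $(-,+,+,+)$. Tildes denote quantities of the metric $\tilde g_{\mu\nu}$ with line element $\widetilde{ds}^2$: $\widetilde R_{\mu\nu}$ and $\widetilde R$ are its Ricci tensor and Ricci scalar (sign convention: round spheres have positive Ricci scalar), $\widetilde\nabla$ its Levi-Civita connection, $\widetilde\Box=\tilde g^{\mu\nu}\widetilde\nabla_\mu\widetilde\nabla_\nu$, and $(\tilde\partial\sigma)^2=\tilde g^{\mu\nu}\partial_\mu\sigma\,\partial_\nu\sigma$. Null coordinates for $r>r_h$: let $T=r_h t$ be the rescaled time, $r^*=\frac{r_h}{2}\log\left(\frac{r^2}{r_h^2}-1\right)$ the tortoise coordinate, and $$u=-r_h\,e^{-(T-r^* )/r_h},\qquad v=r_h\,e^{(T+r^* )/r_h}.$$ *)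

theory Defs
  imports "HOL-Analysis.Analysis"
begin

section \<open>Indices of four-dimensional vectors\<close>

text \<open>In the type \<open>4\<close> the numerals \<open>1, 2, 3, 4\<close> are pairwise distinct and exhaust
  the type (\<open>4 = 0\<close>), so they serve as coordinate indices.\<close>

lemma exhaust_4: "x = 1 \<or> x = 2 \<or> x = 3 \<or> x = (4::4)"
proof (induct x)
  case (of_int z)
  then have "z = 0 \<or> z = 1 \<or> z = 2 \<or> z = 3" by auto
  then show ?case by auto
qed

lemma forall_4: "(\<forall>i::4. P i) \<longleftrightarrow> P 1 \<and> P 2 \<and> P 3 \<and> P 4"
  by (metis exhaust_4)

lemma UNIV_4: "UNIV = {1::4, 2, 3, 4}"
  using exhaust_4 by auto

lemma sum_4: "(\<Sum>i\<in>(UNIV::4 set). f i) = f 1 + f 2 + f 3 + f 4"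
  unfolding UNIV_4 by (simp add: ac_simps)

lemma vector_4 [simp]:
  "(vector [a, b, c, d] :: ('a::zero)^4) $ 1 = a"
  "(vector [a, b, c, d] :: ('a::zero)^4) $ 2 = b"
  "(vector [a, b, c, d] :: ('a::zero)^4) $ 3 = c"
  "(vector [a, b, c, d] :: ('a::zero)^4) $ 4 = d"
  unfolding vector_def by simp_all


section \<open>Calculus in coordinates\<close>

definition partial :: "'n::finite \<Rightarrow> (real^'n \<Rightarrow> real) \<Rightarrow> real^'n \<Rightarrow> real" where
  "partial i f p = deriv (\<lambda>h. f (p + h *\<^sub>R axis i 1)) 0"

text \<open>\<open>C\<close>-infinity on an open set: all iterated partial derivatives (including the
  function itself, for the empty list of indices) are differentiable there.\<close>

definition smooth_on :: "(real^'n::finite) set \<Rightarrow> (real^'n \<Rightarrow> real) \<Rightarrow> bool" where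
  "smooth_on U f \<longleftrightarrow> open U \<and> (\<forall>is. foldr partial is f differentiable_on U)"

definition jacobian :: "(real^'n::finite \<Rightarrow> real^'m::finite) \<Rightarrow> real^'n \<Rightarrow> real^'n^'m" where
  "jacobian \<phi> p = (\<chi> a i. partial i (\<lambda>q. \<phi> q $ a) p)"

definition coordinate_system_on ::
    "(real^'n::finite) set \<Rightarrow> (real^'n \<Rightarrow> real^'n) \<Rightarrow> bool" where
  "coordinate_system_on U \<phi> \<longleftrightarrow>
     (\<forall>a. smooth_on U (\<lambda>p. \<phi> p $ a)) \<and> inj_on \<phi> U \<and> (\<forall>p\<in>U. det (jacobian \<phi> p) \<noteq> 0)"


section \<open>Pseudo-Riemannian geometry in coordinates\<close>

text \<open>A metric is given by its component matrix \<open>g p $ i $ j\<close> at the point with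
  coordinates \<open>p\<close>.\<close>

type_synonym 'n metric = "real^'n \<Rightarrow> real^'n^'n"

text \<open>By Sylvester's law a symmetric matrix has signature \<open>(-,+,\<dots>,+)\<close> iff it is
  congruent to the Minkowski matrix; the columns of \<open>E\<close> are an orthonormal frame.\<close>

definition lorentzian_metric_on :: "(real^'n::finite) set \<Rightarrow> 'n metric \<Rightarrow> bool" where
  "lorentzian_metric_on U g \<longleftrightarrow>
     (\<forall>i j. smooth_on U (\<lambda>p. g p $ i $ j)) \<and>
     (\<forall>p\<in>U. transpose (g p) = g p \<and>
        (\<exists>(E::real^'n^'n) i0. invertible E \<and>
           transpose E ** g p ** E =
             (\<chi> i j. if i \<noteq> j then 0 else if i = i0 then -1 else 1)))"

definition inv_metric :: "'n::finite metric \<Rightarrow> 'n metric" where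
  "inv_metric g p = matrix_inv (g p)"

text \<open>\<open>christoffel g k i j\<close> is \<open>\<Gamma>\<^sup>k\<^sub>i\<^sub>j\<close> of the Levi-Civita connection.\<close>

definition christoffel ::
    "'n::finite metric \<Rightarrow> 'n \<Rightarrow> 'n \<Rightarrow> 'n \<Rightarrow> real^'n \<Rightarrow> real" where
  "christoffel g k i j p =
     1/2 * (\<Sum>l\<in>UNIV. inv_metric g p $ k $ l *
       (partial i (\<lambda>q. g q $ l $ j) p + partial j (\<lambda>q. g q $ l $ i) p
        - partial l (\<lambda>q. g q $ i $ j) p))"

text \<open>\<open>riemann g k l i j\<close> is \<open>R\<^sup>k\<^sub>l\<^sub>i\<^sub>j\<close>, with
  \<open>[\<nabla>\<^sub>i, \<nabla>\<^sub>j] V\<^sup>k = R\<^sup>k\<^sub>l\<^sub>i\<^sub>j V\<^sup>l\<close>. Contracting the first with the third index makes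
  the Ricci scalar of round spheres positive.\<close>

definition riemann ::
    "'n::finite metric \<Rightarrow> 'n \<Rightarrow> 'n \<Rightarrow> 'n \<Rightarrow> 'n \<Rightarrow> real^'n \<Rightarrow> real" where
  "riemann g k l i j p =
     partial i (christoffel g k j l) p - partial j (christoffel g k i l) p
     + (\<Sum>m\<in>UNIV. christoffel g k i m p * christoffel g m j l p
                  - christoffel g k j m p * christoffel g m i l p)"

definition ricci :: "'n::finite metric \<Rightarrow> 'n \<Rightarrow> 'n \<Rightarrow> real^'n \<Rightarrow> real" where
  "ricci g i j p = (\<Sum>k\<in>UNIV. riemann g k i k j p)"

definition trace_metric ::
    "'n::finite metric \<Rightarrow> ('n \<Rightarrow> 'n \<Rightarrow> real^'n \<Rightarrow> real) \<Rightarrow> real^'n \<Rightarrow> real" where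
  "trace_metric g T p = (\<Sum>i\<in>UNIV. \<Sum>j\<in>UNIV. inv_metric g p $ i $ j * T i j p)"

definition ricci_scalar :: "'n::finite metric \<Rightarrow> real^'n \<Rightarrow> real" where
  "ricci_scalar g = trace_metric g (ricci g)"

text \<open>\<open>cov_deriv g \<omega> i j\<close> is \<open>\<nabla>\<^sub>i \<omega>\<^sub>j\<close> for a covector field \<open>\<omega>\<close>; for a scalar field,
  \<open>\<nabla>\<^sub>j \<sigma> = \<partial>\<^sub>j \<sigma>\<close>.\<close>

definition cov_deriv ::
    "'n::finite metric \<Rightarrow> ('n \<Rightarrow> real^'n \<Rightarrow> real) \<Rightarrow> 'n \<Rightarrow> 'n \<Rightarrow> real^'n \<Rightarrow> real" where
  "cov_deriv g \<omega> i j p = partial i (\<omega> j) p - (\<Sum>k\<in>UNIV. christoffel g k i j p * \<omega> k p)"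

definition cov_hessian ::
    "'n::finite metric \<Rightarrow> (real^'n \<Rightarrow> real) \<Rightarrow> 'n \<Rightarrow> 'n \<Rightarrow> real^'n \<Rightarrow> real" where
  "cov_hessian g \<sigma> = cov_deriv g (\<lambda>j. partial j \<sigma>)"

definition dalembertian :: "'n::finite metric \<Rightarrow> (real^'n \<Rightarrow> real) \<Rightarrow> real^'n \<Rightarrow> real" where
  "dalembertian g \<sigma> = trace_metric g (cov_hessian g \<sigma>)"

definition grad_sq :: "'n::finite metric \<Rightarrow> (real^'n \<Rightarrow> real) \<Rightarrow> real^'n \<Rightarrow> real" where
  "grad_sq g \<sigma> = trace_metric g (\<lambda>i j p. partial i \<sigma> p * partial j \<sigma> p)"

text \<open>Pullback \<open>(\<phi>\<^sup>* h)\<^sub>i\<^sub>j = h\<^sub>a\<^sub>b(\<phi>(p)) \<partial>\<^sub>i \<phi>\<^sup>a \<partial>\<^sub>j \<phi>\<^sup>b\<close>. That a metric \<open>g\<close> reads \<open>h\<close> in terms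
  of the coordinates \<open>\<phi>\<close> means that \<open>g\<close> is the pullback of \<open>h\<close>.\<close>

definition pullback_metric ::
    "(real^'n::finite \<Rightarrow> real^'m::finite) \<Rightarrow> 'm metric \<Rightarrow> 'n metric" where
  "pullback_metric \<phi> h p = transpose (jacobian \<phi> p) ** h (\<phi> p) ** jacobian \<phi> p"


section \<open>The background\<close>

text \<open>Points are \<open>p = (t, r, x, y)\<close>, i.e. \<open>p $ 1 = t\<close>, \<open>p $ 2 = r\<close>, \<open>p $ 3 = x\<close>,
  \<open>p $ 4 = y\<close>.\<close>

definition exterior_region :: "real \<Rightarrow> (real^4) set" where
  "exterior_region rh = {p. p $ 2 > rh}"

definition string_metric :: "real \<Rightarrow> real \<Rightarrow> 4 metric" where
  "string_metric k rh p =
     (let r = p $ 2; f = 1 - rh\<^sup>2 / r\<^sup>2 in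
      (1 / k\<^sup>2) *\<^sub>R vector
        [vector [- f, 0,               0, 0],
         vector [0,   1 / (r\<^sup>2 * f), 0, 0],
         vector [0,   0,               1, 0],
         vector [0,   0,               0, 1]])"

definition dilaton :: "real \<Rightarrow> real \<Rightarrow> real^4 \<Rightarrow> real" where
  "dilaton k \<sigma>0 p = - 2 * ln (k * p $ 2) - \<sigma>0"

definition tortoise :: "real \<Rightarrow> real \<Rightarrow> real" where
  "tortoise rh r = rh / 2 * ln (r\<^sup>2 / rh\<^sup>2 - 1)"

definition null_u :: "real \<Rightarrow> real \<Rightarrow> real \<Rightarrow> real" where
  "null_u rh t r = (let T = rh * t in - rh * exp (- (T - tortoise rh r) / rh))"

definition null_v :: "real \<Rightarrow> real \<Rightarrow> real \<Rightarrow> real" where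
  "null_v rh t r = (let T = rh * t in rh * exp ((T + tortoise rh r) / rh))"

text \<open>The map \<open>(t, r, x, y) \<mapsto> (u, v, x, y)\<close>.\<close>

definition null_coords :: "real \<Rightarrow> real^4 \<Rightarrow> real^4" where
  "null_coords rh p = vector [null_u rh (p $ 1) (p $ 2), null_v rh (p $ 1) (p $ 2), p $ 3, p $ 4]"

text \<open>The line element \<open>- k\<^sup>-\<^sup>2 du dv / (rh\<^sup>2 - u v)\<close> in coordinates \<open>w = (u, v)\<close>. As a
  quadratic form, \<open>du dv\<close> has the components \<open>1/2\<close> in both off-diagonal places.\<close>

definition witten_metric :: "real \<Rightarrow> real \<Rightarrow> 2 metric" where
  "witten_metric k rh w =
     (let c = - (1 / k\<^sup>2) * (1 / 2) / (rh\<^sup>2 - w $ 1 * w $ 2) in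
      vector [vector [0, c],
              vector [c, 0]])"

text \<open>Product of the Witten black hole with two flat directions \<open>k\<^sup>-\<^sup>2 (dx\<^sup>2 + dy\<^sup>2)\<close>, in
  coordinates \<open>q = (u, v, x, y)\<close>.\<close>

definition witten_times_flat :: "real \<Rightarrow> real \<Rightarrow> 4 metric" where
  "witten_times_flat k rh q =
     (let W = witten_metric k rh (vector [q $ 1, q $ 2]) in
      vector
        [vector [W $ 1 $ 1, W $ 1 $ 2, 0,         0],
         vector [W $ 2 $ 1, W $ 2 $ 2, 0,         0],
         vector [0,         0,         1 / k\<^sup>2, 0],
         vector [0,         0,         0,         1 / k\<^sup>2]])"

end

(* The metric is diagonal and depends on r alone, so the only Christoffel symbols are
   Gamma^t_tr, Gamma^r_tt and Gamma^r_rr; the only nonzero components of the Ricci tensor and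
   of the Hessian of sigma are tt and rr, and they cancel. In the null coordinates
   u v = rh^2 - r^2, which turns the conformal factor 1 / (rh^2 - u v) into 1 / r^2. *)

theory Submission
  imports Defs
begin

section \<open>Partial derivatives\<close>

text \<open>Chain rule along the coordinate line: \<open>partial\<close> is a one-variable
  \<open>deriv\<close>, so a total derivative determines it by evaluation on the basis
  vector.\<close>

lemma partial_eq_of_has_derivative:
  assumes "(f has_derivative D) (at p)"
  shows "partial i f p = D (axis i 1)"
proof -
  have "((\<lambda>h::real. p + h *\<^sub>R axis i 1) has_derivative (\<lambda>h. h *\<^sub>R axis i 1)) (at 0)"
    by (auto intro!: derivative_eq_intros)
  moreover have "(f has_derivative D) (at (p + 0 *\<^sub>R axis i 1))"
    using assms by simp
  ultimately have "((\<lambda>h. f (p + h *\<^sub>R axis i 1)) has_derivative (\<lambda>h. D (h *\<^sub>R axis i 1))) (at 0)"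
    by (rule has_derivative_compose)
  moreover have "D (h *\<^sub>R axis i 1) = D (axis i 1) * h" for h
    using linear_scale[OF has_derivative_linear[OF assms]] by simp
  ultimately show ?thesis
    unfolding partial_def by (intro DERIV_imp_deriv) (simp add: has_field_derivative_def)
qed

text \<open>The coordinate line through \<open>p\<close> stays in the open set for small parameters,
  and \<open>deriv\<close> sees only values near 0. Closed forms known only on a region may thus be
  substituted under a further derivative.\<close>

lemma partial_cong_open:
  assumes "open U" "p \<in> U" and eq: "\<And>q. q \<in> U \<Longrightarrow> f q = g q"
  shows "partial i f p = partial i g p"
proof -
  have "open ((\<lambda>h::real. p + h *\<^sub>R axis i 1) -` U)"
    using assms(1) by (intro open_vimage continuous_intros)
  moreover have "0 \<in> (\<lambda>h::real. p + h *\<^sub>R axis i 1) -` U"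
    using assms(2) by simp
  ultimately have "\<forall>\<^sub>F h in nhds 0. h \<in> (\<lambda>h::real. p + h *\<^sub>R axis i 1) -` U"
    by (rule eventually_nhds_in_open)
  then show ?thesis
    unfolding partial_def by (intro deriv_cong_ev) (auto elim!: eventually_mono simp: eq)
qed

text \<open>The metric, its Christoffel symbols and the dilaton depend on r alone; this reduces all
  their partial derivatives to one-variable calculus.\<close>

lemma partial_component:
  assumes "(F has_real_derivative d) (at (p $ j))"
  shows "partial i (\<lambda>q. F (q $ j)) p = (if i = j then d else 0)"
proof -
  have "((\<lambda>q. q $ j) has_derivative (\<lambda>q. q $ j)) (at p)"
    by (intro bounded_linear_imp_has_derivative bounded_linear_vec_nth)
  from has_derivative_compose[OF this assms[unfolded has_field_derivative_def]]
  show ?thesis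
    by (auto simp: partial_eq_of_has_derivative axis_def)
qed


section \<open>Smoothness of elementary functions\<close>

text \<open>Closed under partial derivatives up to equality on \<open>U\<close>, hence consisting of smooth functions.\<close>

inductive elementary_on :: "(real^'n::finite) set \<Rightarrow> (real^'n \<Rightarrow> real) \<Rightarrow> bool"
  for U where
  const: "elementary_on U (\<lambda>p. c)"
| component: "elementary_on U (\<lambda>p. p $ i)"
| add: "elementary_on U f \<Longrightarrow> elementary_on U g \<Longrightarrow> elementary_on U (\<lambda>p. f p + g p)"
| mult: "elementary_on U f \<Longrightarrow> elementary_on U g \<Longrightarrow> elementary_on U (\<lambda>p. f p * g p)"
| inverse: "elementary_on U f \<Longrightarrow> (\<And>p. p \<in> U \<Longrightarrow> f p \<noteq> 0) \<Longrightarrow> elementary_on U (\<lambda>p. inverse (f p))"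
| exp: "elementary_on U f \<Longrightarrow> elementary_on U (\<lambda>p. exp (f p))"
| ln: "elementary_on U f \<Longrightarrow> (\<And>p. p \<in> U \<Longrightarrow> f p > 0) \<Longrightarrow> elementary_on U (\<lambda>p. ln (f p))"

lemma elementary_on_minus:
  "elementary_on U f \<Longrightarrow> elementary_on U (\<lambda>p. - f p)"
  using elementary_on.mult[OF elementary_on.const[of U "-1"]] by force

lemma elementary_on_diff:
  "elementary_on U f \<Longrightarrow> elementary_on U g \<Longrightarrow> elementary_on U (\<lambda>p. f p - g p)"
  using elementary_on.add[OF _ elementary_on_minus] by force

lemma elementary_on_divide:
  "elementary_on U f \<Longrightarrow> elementary_on U g \<Longrightarrow> (\<And>p. p \<in> U \<Longrightarrow> g p \<noteq> 0) \<Longrightarrow>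
    elementary_on U (\<lambda>p. f p / g p)"
  unfolding divide_inverse by (intro elementary_on.mult elementary_on.inverse)

lemma elementary_on_power2:
  "elementary_on U f \<Longrightarrow> elementary_on U (\<lambda>p. (f p)\<^sup>2)"
  unfolding power2_eq_square by (intro elementary_on.mult)

lemmas elementary_on_intros = elementary_on.intros elementary_on_minus elementary_on_diff
  elementary_on_divide elementary_on_power2

text \<open>Sum, product and chain rules keep the derivative in the class. The direction
  \<open>v\<close> is held fixed, so that \<open>D p v\<close> is again a scalar function of
  \<open>p\<close> and the argument can be iterated.\<close>

lemma elementary_on_has_derivative:
  assumes "elementary_on U f"
  shows "\<exists>D. (\<forall>v. elementary_on U (\<lambda>p. D p v)) \<and> (\<forall>p\<in>U. (f has_derivative D p) (at p))"
  using assms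
proof induction
  case (const c)
  show ?case
    by (intro exI[of _ "\<lambda>p v. 0"]) (auto intro: elementary_on.const)
next
  case (component i)
  show ?case
    by (intro exI[of _ "\<lambda>p v. v $ i"] conjI ballI allI elementary_on.const
        bounded_linear_imp_has_derivative bounded_linear_vec_nth)
next
  case (add f g)
  then obtain D E where
    "\<forall>v. elementary_on U (\<lambda>p. D p v)" "\<forall>p\<in>U. (f has_derivative D p) (at p)"
    "\<forall>v. elementary_on U (\<lambda>p. E p v)" "\<forall>p\<in>U. (g has_derivative E p) (at p)"
    by metis
  then show ?case
    by (intro exI[of _ "\<lambda>p v. D p v + E p v"])
      (auto intro!: elementary_on.intros derivative_intros)
next
  case (mult f g)
  then obtain D E where
    "\<forall>v. elementary_on U (\<lambda>p. D p v)" "\<forall>p\<in>U. (f has_derivative D p) (at p)"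
    "\<forall>v. elementary_on U (\<lambda>p. E p v)" "\<forall>p\<in>U. (g has_derivative E p) (at p)"
    by metis
  with mult.hyps show ?case
    by (intro exI[of _ "\<lambda>p v. f p * E p v + D p v * g p"])
      (auto intro!: elementary_on.intros derivative_intros)
next
  case (inverse f)
  then obtain D where
    "\<forall>v. elementary_on U (\<lambda>p. D p v)" "\<forall>p\<in>U. (f has_derivative D p) (at p)"
    by metis
  with inverse.hyps show ?case
    by (intro exI[of _ "\<lambda>p v. - (inverse (f p) * D p v * inverse (f p))"])
      (auto intro!: elementary_on_intros derivative_intros)
next
  case (exp f)
  then obtain D where
    "\<forall>v. elementary_on U (\<lambda>p. D p v)" "\<forall>p\<in>U. (f has_derivative D p) (at p)"
    by metis
  with exp.hyps show ?case
    by (intro exI[of _ "\<lambda>p v. D p v * exp (f p)"])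
      (auto intro!: elementary_on.intros derivative_eq_intros)
next
  case (ln f)
  then obtain D where
    "\<forall>v. elementary_on U (\<lambda>p. D p v)" "\<forall>p\<in>U. (f has_derivative D p) (at p)"
    by metis
  moreover have "f p \<noteq> 0" if "p \<in> U" for p
    using ln.hyps(2)[OF that] by simp
  ultimately show ?case using ln.hyps
    by (intro exI[of _ "\<lambda>p v. D p v * inverse (f p)"])
      (auto intro!: elementary_on.intros derivative_eq_intros)
qed

text \<open>Each differentiation replaces the current function by an elementary one that agrees with
  it on \<open>U\<close>; because \<open>U\<close> is open, the next partial derivative does not see
  the difference.\<close>

lemma elementary_on_foldr_partial:
  assumes "open U" "elementary_on U f"
  shows "\<exists>g. elementary_on U g \<and> (\<forall>p\<in>U. foldr partial is f p = g p)"
proof (induction "is")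
  case Nil
  then show ?case using assms by auto
next
  case (Cons i "is")
  then obtain g where g: "elementary_on U g" "\<forall>p\<in>U. foldr partial is f p = g p"
    by blast
  obtain D where D: "\<forall>v. elementary_on U (\<lambda>p. D p v)" "\<forall>p\<in>U. (g has_derivative D p) (at p)"
    using elementary_on_has_derivative[OF g(1)] by metis
  have "foldr partial (i # is) f p = D p (axis i 1)" if "p \<in> U" for p
    using partial_cong_open[OF assms(1) that, of "foldr partial is f" g i] g(2) D(2) that
    by (simp add: partial_eq_of_has_derivative)
  with D(1) show ?case by blast
qed

lemma elementary_on_imp_smooth_on:
  assumes "open U" "elementary_on U f"
  shows "smooth_on U f"
  unfolding smooth_on_def
proof (intro conjI allI assms(1))
  fix "is"
  obtain g where g: "elementary_on U g" "\<forall>p\<in>U. foldr partial is f p = g p"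
    using elementary_on_foldr_partial[OF assms] by blast
  then obtain D where D: "\<forall>p\<in>U. (g has_derivative D p) (at p)"
    using elementary_on_has_derivative by blast
  show "foldr partial is f differentiable_on U"
    unfolding differentiable_on_def
  proof
    fix p assume p: "p \<in> U"
    with D have "g differentiable (at p within U)"
      by (auto intro: differentiableI has_derivative_at_withinI)
    \<comment> \<open>Differentiability within \<open>U\<close> compares the two functions only at
      points of \<open>U\<close>, where they agree, so the radius 1 is arbitrary.\<close>
    then show "foldr partial is f differentiable (at p within U)"
      by (rule differentiable_transform_within[OF _ zero_less_one p]) (simp add: g(2))
  qed
qed


section \<open>Diagonal matrices\<close>

text \<open>In this form the inverse, the determinant and the congruence to the Minkowski matrix
  become entrywise operations.\<close>

definition diag_matrix :: "('n \<Rightarrow> 'a::zero) \<Rightarrow> 'a^'n^'n" where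
  "diag_matrix d = (\<chi> i j. if i = j then d i else 0)"

lemma diag_matrix_nth [simp]: "diag_matrix d $ i $ j = (if i = j then d i else 0)"
  by (simp add: diag_matrix_def)

lemma diag_matrix_mult:
  "diag_matrix d ** diag_matrix e = diag_matrix (\<lambda>i::'n::finite. d i * e i :: real)"
proof -
  \<comment> \<open>Merging the two conditions leaves a single test on \<open>k\<close>, so the sum
    collapses to one term.\<close>
  have "(\<Sum>k\<in>UNIV. (if i = k then d i else 0) * (if k = j then e k else 0)) =
      (\<Sum>k\<in>UNIV. if i = k then (if i = j then d i * e i else 0) else 0)" for i j
    by (intro sum.cong) auto
  then show ?thesis
    by (simp add: vec_eq_iff matrix_matrix_mult_def)
qed

lemma transpose_diag_matrix: "transpose (diag_matrix d) = diag_matrix d"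
  by (simp add: vec_eq_iff transpose_def)

lemma det_diag_matrix: "det (diag_matrix d) = (\<Prod>i\<in>UNIV. d i :: real)"
  by (subst det_diagonal) auto

lemma diag_matrix_inverse:
  assumes "\<And>i::'n::finite. d i \<noteq> (0::real)"
  shows "diag_matrix d ** diag_matrix (\<lambda>i. 1 / d i) = mat 1"
    and "diag_matrix (\<lambda>i. 1 / d i) ** diag_matrix d = mat 1"
  using assms by (simp_all add: diag_matrix_mult) (simp_all add: vec_eq_iff mat_def)

lemma matrix_inv_diag_matrix:
  assumes "\<And>i::'n::finite. d i \<noteq> (0::real)"
  shows "matrix_inv (diag_matrix d) = diag_matrix (\<lambda>i. 1 / d i)"
proof -
  note inv = diag_matrix_inverse[of d, OF assms]
  have "invertible (diag_matrix d)"
    using inv unfolding invertible_def by blast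
  \<comment> \<open>\<open>matrix_inv\<close> is a choice among two-sided inverses. Being a left
    inverse already determines it: multiply by the explicit right inverse.\<close>
  then have "matrix_inv (diag_matrix d) ** diag_matrix d = mat 1"
    unfolding matrix_inv_def invertible_def by (rule someI2_ex) blast
  then have "matrix_inv (diag_matrix d) ** (diag_matrix d ** diag_matrix (\<lambda>i. 1 / d i)) =
    diag_matrix (\<lambda>i. 1 / d i)"
    by (simp add: matrix_mul_assoc)
  then show ?thesis
    by (simp add: inv)
qed

text \<open>Rescaling the i-th basis vector by \<open>1 / sqrt \<bar>d i\<bar>\<close> normalises
  its square to the sign of \<open>d i\<close>, which gives an orthonormal frame.\<close>

lemma lorentzian_diag_matrix:
  assumes "d i0 < 0" "\<And>i::'n::finite. i \<noteq> i0 \<Longrightarrow> d i > (0::real)"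
  shows "\<exists>(E::real^'n^'n) i0. invertible E \<and> transpose E ** diag_matrix d ** E =
    (\<chi> i j. if i \<noteq> j then 0 else if i = i0 then -1 else 1)"
proof (intro exI conjI)
  define E where "E = diag_matrix (\<lambda>i. 1 / sqrt \<bar>d i\<bar>)"
  have nz: "d i \<noteq> 0" for i
    using assms by (metis less_irrefl)
  show "invertible E"
    unfolding invertible_det_nz E_def using nz by (simp add: det_diag_matrix)
  show "transpose E ** diag_matrix d ** E =
    (\<chi> i j. if i \<noteq> j then 0 else if i = i0 then -1 else 1)"
  proof -
    have "1 / sqrt \<bar>d i\<bar> * d i * (1 / sqrt \<bar>d i\<bar>) = (if i = i0 then - 1 else 1)" for i
    proof -
      have "1 / sqrt \<bar>d i\<bar> * d i * (1 / sqrt \<bar>d i\<bar>) = d i / \<bar>d i\<bar>"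
        by simp
      also have "\<dots> = (if i = i0 then - 1 else 1)"
        using assms(1) assms(2)[of i] by auto
      finally show ?thesis .
    qed
    then show ?thesis
      unfolding E_def transpose_diag_matrix diag_matrix_mult by (simp add: vec_eq_iff)
  qed
qed


section \<open>The metric\<close>

lemma open_exterior_region: "open (exterior_region rh)"
  unfolding exterior_region_def by (intro open_Collect_less continuous_intros)

lemma lapse_pos:
  fixes r rh :: real
  assumes "rh > 0" "r > rh"
  shows "1 - rh\<^sup>2 / r\<^sup>2 > 0" "r\<^sup>2 > rh\<^sup>2" "r\<^sup>2 / rh\<^sup>2 - 1 > 0"
proof -
  show "r\<^sup>2 > rh\<^sup>2" using assms by (simp add: power_strict_mono)
  then show "1 - rh\<^sup>2 / r\<^sup>2 > 0" "r\<^sup>2 / rh\<^sup>2 - 1 > 0" using assms by simp_all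
qed

text \<open>The diagonal entries as functions of the real variable r instead of the point, so that
  \<open>partial_component\<close> applies.\<close>

definition metric_diag :: "real \<Rightarrow> real \<Rightarrow> 4 \<Rightarrow> real \<Rightarrow> real" where
  "metric_diag k rh i r = 1 / k\<^sup>2 *
    (if i = 1 then - (1 - rh\<^sup>2 / r\<^sup>2) else if i = 2 then 1 / (r\<^sup>2 * (1 - rh\<^sup>2 / r\<^sup>2)) else 1)"

lemma string_metric_eq_diag:
  "string_metric k rh p = diag_matrix (\<lambda>i. metric_diag k rh i (p $ 2))"
  by (simp add: vec_eq_iff forall_4 string_metric_def Let_def metric_diag_def)

text \<open>Without nested fractions the only denominators are r^2 and r^2 - rh^2, both positive
  outside the horizon.\<close>

lemma metric_diag_eq:
  assumes "rh > 0" "r > rh"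
  shows "metric_diag k rh i r = 1 / k\<^sup>2 *
    (if i = 1 then - ((r\<^sup>2 - rh\<^sup>2) / r\<^sup>2) else if i = 2 then 1 / (r\<^sup>2 - rh\<^sup>2) else 1)"
proof -
  have "1 - rh\<^sup>2 / r\<^sup>2 = (r\<^sup>2 - rh\<^sup>2) / r\<^sup>2" "r \<noteq> 0"
    using assms by (simp_all add: diff_divide_distrib)
  then show ?thesis
    by (simp add: metric_diag_def)
qed

lemma metric_diag_has_derivative:
  assumes "rh > 0" "r > rh"
  shows "(metric_diag k rh i has_real_derivative 1 / k\<^sup>2 *
    (if i = 1 then - 2 * rh\<^sup>2 / r ^ 3 else if i = 2 then - 2 * r / (r\<^sup>2 - rh\<^sup>2)\<^sup>2 else 0)) (at r)"
proof -
  have nz: "r \<noteq> 0" "r\<^sup>2 - rh\<^sup>2 \<noteq> 0"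
    using assms lapse_pos(2)[OF assms] by auto
  let ?f = "\<lambda>r. if i = 1 then - ((r\<^sup>2 - rh\<^sup>2) / r\<^sup>2) else if i = 2 then 1 / (r\<^sup>2 - rh\<^sup>2) else 1"
  have "(?f has_real_derivative
    (if i = 1 then - 2 * rh\<^sup>2 / r ^ 3 else if i = 2 then - 2 * r / (r\<^sup>2 - rh\<^sup>2)\<^sup>2 else 0)) (at r)"
    using nz
    by (cases "i = 1"; cases "i = 2")
      (auto intro!: derivative_eq_intros simp: divide_simps power2_eq_square power3_eq_cube algebra_simps)
  then have "((\<lambda>r. 1 / k\<^sup>2 * ?f r) has_real_derivative 1 / k\<^sup>2 *
    (if i = 1 then - 2 * rh\<^sup>2 / r ^ 3 else if i = 2 then - 2 * r / (r\<^sup>2 - rh\<^sup>2)\<^sup>2 else 0)) (at r)"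
    by (rule DERIV_cmult)
  \<comment> \<open>The derivative was computed for the form without nested fractions, which agrees
    with \<open>metric_diag\<close> on the open half-line r > rh.\<close>
  then show ?thesis
    by (rule has_field_derivative_transform_within_open[where S = "{rh<..}"])
      (use assms in \<open>auto simp: metric_diag_eq\<close>)
qed

lemma metric_diag_sign:
  assumes "k > 0" "rh > 0" "r > rh"
  shows "metric_diag k rh 1 r < 0" "i \<noteq> 1 \<Longrightarrow> metric_diag k rh i r > 0"
  using assms lapse_pos[OF assms(2,3)]
  by (auto simp: metric_diag_eq)

lemma metric_diag_nonzero:
  assumes "k > 0" "rh > 0" "r > rh"
  shows "metric_diag k rh i r \<noteq> 0"
  using metric_diag_sign(1)[OF assms] metric_diag_sign(2)[OF assms, of i] by (cases "i = 1") auto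

lemma lorentzian_string_metric:
  assumes "k > 0" "rh > 0"
  shows "lorentzian_metric_on (exterior_region rh) (string_metric k rh)"
  unfolding lorentzian_metric_on_def
proof (intro conjI allI ballI)
  fix i j :: 4
  have *: "p $ 2 \<noteq> 0" "(p $ 2)\<^sup>2 * (1 - rh\<^sup>2 / (p $ 2)\<^sup>2) \<noteq> 0" if "p \<in> exterior_region rh" for p
    using that assms lapse_pos[OF assms(2), of "p $ 2"] by (auto simp: exterior_region_def)
  show "smooth_on (exterior_region rh) (\<lambda>p. string_metric k rh p $ i $ j)"
    unfolding string_metric_eq_diag diag_matrix_nth metric_diag_def
    using * assms
    by (intro elementary_on_imp_smooth_on open_exterior_region)
      (cases "i = j"; cases "i = 1"; cases "i = 2"; auto intro!: elementary_on_intros)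
next
  fix p :: "real^4"
  assume "p \<in> exterior_region rh"
  then have r: "p $ 2 > rh" by (simp add: exterior_region_def)
  show "transpose (string_metric k rh p) = string_metric k rh p"
    by (simp add: string_metric_eq_diag transpose_diag_matrix)
  show "\<exists>(E::real^4^4) i0. invertible E \<and> transpose E ** string_metric k rh p ** E =
    (\<chi> i j. if i \<noteq> j then 0 else if i = i0 then -1 else 1)"
    unfolding string_metric_eq_diag
    using metric_diag_sign[OF assms r] by (intro lorentzian_diag_matrix)
qed

lemma inv_string_metric:
  assumes "k > 0" "rh > 0" "p \<in> exterior_region rh"
  shows "inv_metric (string_metric k rh) p = diag_matrix (\<lambda>i. 1 / metric_diag k rh i (p $ 2))"
  using assms unfolding inv_metric_def string_metric_eq_diag
  by (intro matrix_inv_diag_matrix metric_diag_nonzero) (auto simp: exterior_region_def)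


section \<open>Curvature and dilaton\<close>

text \<open>The first index is the upper one, with 1 = t and 2 = r. The factor k^-2 cancels between
  the metric and its inverse, so \<open>k\<close> is not a parameter.\<close>

definition string_christoffel :: "real \<Rightarrow> 4 \<Rightarrow> 4 \<Rightarrow> 4 \<Rightarrow> real \<Rightarrow> real" where
  "string_christoffel rh l i j r =
    (if l = 1 \<and> (i = 1 \<and> j = 2 \<or> i = 2 \<and> j = 1) then rh\<^sup>2 / (r * (r\<^sup>2 - rh\<^sup>2))
     else if l = 2 \<and> i = 1 \<and> j = 1 then rh\<^sup>2 * (r\<^sup>2 - rh\<^sup>2) / r ^ 3
     else if l = 2 \<and> i = 2 \<and> j = 2 then - r / (r\<^sup>2 - rh\<^sup>2)
     else 0)"

definition string_christoffel_deriv :: "real \<Rightarrow> 4 \<Rightarrow> 4 \<Rightarrow> 4 \<Rightarrow> real \<Rightarrow> real" where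
  "string_christoffel_deriv rh l i j r =
    (if l = 1 \<and> (i = 1 \<and> j = 2 \<or> i = 2 \<and> j = 1)
       then - rh\<^sup>2 * (3 * r\<^sup>2 - rh\<^sup>2) / (r * (r\<^sup>2 - rh\<^sup>2))\<^sup>2
     else if l = 2 \<and> i = 1 \<and> j = 1 then rh\<^sup>2 * (3 * rh\<^sup>2 - r\<^sup>2) / r ^ 4
     else if l = 2 \<and> i = 2 \<and> j = 2 then (r\<^sup>2 + rh\<^sup>2) / (r\<^sup>2 - rh\<^sup>2)\<^sup>2
     else 0)"

text \<open>Evaluation at numerals for collapsing the index sums; the last six equations discard
  every symbol with an x or y index.\<close>

lemma string_christoffel_simps:
  "string_christoffel rh 1 1 1 r = 0"
  "string_christoffel rh 1 1 2 r = rh\<^sup>2 / (r * (r\<^sup>2 - rh\<^sup>2))"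
  "string_christoffel rh 1 2 1 r = rh\<^sup>2 / (r * (r\<^sup>2 - rh\<^sup>2))"
  "string_christoffel rh 1 2 2 r = 0"
  "string_christoffel rh 2 1 1 r = rh\<^sup>2 * (r\<^sup>2 - rh\<^sup>2) / r ^ 3"
  "string_christoffel rh 2 1 2 r = 0"
  "string_christoffel rh 2 2 1 r = 0"
  "string_christoffel rh 2 2 2 r = - r / (r\<^sup>2 - rh\<^sup>2)"
  "string_christoffel rh 3 i j r = 0"
  "string_christoffel rh 4 i j r = 0"
  "string_christoffel rh l 3 j r = 0"
  "string_christoffel rh l 4 j r = 0"
  "string_christoffel rh l i 3 r = 0"
  "string_christoffel rh l i 4 r = 0"
  by (simp_all add: string_christoffel_def)

lemma string_christoffel_deriv_simps:
  "string_christoffel_deriv rh 1 1 1 r = 0"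
  "string_christoffel_deriv rh 1 1 2 r = - rh\<^sup>2 * (3 * r\<^sup>2 - rh\<^sup>2) / (r * (r\<^sup>2 - rh\<^sup>2))\<^sup>2"
  "string_christoffel_deriv rh 1 2 1 r = - rh\<^sup>2 * (3 * r\<^sup>2 - rh\<^sup>2) / (r * (r\<^sup>2 - rh\<^sup>2))\<^sup>2"
  "string_christoffel_deriv rh 1 2 2 r = 0"
  "string_christoffel_deriv rh 2 1 1 r = rh\<^sup>2 * (3 * rh\<^sup>2 - r\<^sup>2) / r ^ 4"
  "string_christoffel_deriv rh 2 1 2 r = 0"
  "string_christoffel_deriv rh 2 2 1 r = 0"
  "string_christoffel_deriv rh 2 2 2 r = (r\<^sup>2 + rh\<^sup>2) / (r\<^sup>2 - rh\<^sup>2)\<^sup>2"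
  "string_christoffel_deriv rh 3 i j r = 0"
  "string_christoffel_deriv rh 4 i j r = 0"
  "string_christoffel_deriv rh l 3 j r = 0"
  "string_christoffel_deriv rh l 4 j r = 0"
  "string_christoffel_deriv rh l i 3 r = 0"
  "string_christoffel_deriv rh l i 4 r = 0"
  by (simp_all add: string_christoffel_deriv_def)

lemma partial_string_metric:
  assumes "k > 0" "rh > 0" "p \<in> exterior_region rh"
  defines "r \<equiv> p $ 2"
  shows "partial l (\<lambda>q. string_metric k rh q $ i $ j) p =
    (if l = 2 \<and> i = j then 1 / k\<^sup>2 *
      (if i = 1 then - 2 * rh\<^sup>2 / r ^ 3 else if i = 2 then - 2 * r / (r\<^sup>2 - rh\<^sup>2)\<^sup>2 else 0) else 0)"
proof -
  have "((\<lambda>r. if i = j then metric_diag k rh i r else 0) has_real_derivative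
    (if i = j then 1 / k\<^sup>2 *
      (if i = 1 then - 2 * rh\<^sup>2 / r ^ 3 else if i = 2 then - 2 * r / (r\<^sup>2 - rh\<^sup>2)\<^sup>2 else 0) else 0)) (at r)"
    using metric_diag_has_derivative[OF assms(2), of r k i] assms(3)
    by (auto simp: r_def exterior_region_def)
  from partial_component[OF this[unfolded r_def], of l] show ?thesis
    by (simp add: string_metric_eq_diag r_def)
qed

lemma christoffel_string_metric:
  assumes "k > 0" "rh > 0" "p \<in> exterior_region rh"
  shows "christoffel (string_metric k rh) l i j p = string_christoffel rh l i j (p $ 2)"
proof -
  define r where "r = p $ 2"
  have r: "r > rh" "r > 0" using assms by (auto simp: exterior_region_def r_def)
  note pos = lapse_pos[OF assms(2) r(1)]
  \<comment> \<open>The inverse metric is diagonal, so only the summand with index \<open>l\<close>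
    survives. What remains is a check of all index values.\<close>
  have *: "christoffel (string_metric k rh) l i j p =
    1/2 * (1 / metric_diag k rh l r *
       (partial i (\<lambda>q. string_metric k rh q $ l $ j) p + partial j (\<lambda>q. string_metric k rh q $ l $ i) p
        - partial l (\<lambda>q. string_metric k rh q $ i $ j) p))"
    unfolding christoffel_def inv_string_metric[OF assms] diag_matrix_nth r_def
    by (simp add: if_distrib if_distribR cong: if_cong)
  have nz: "r \<noteq> 0" "r\<^sup>2 \<noteq> rh\<^sup>2" "k \<noteq> 0"
    using r pos assms(1) by auto
  note unfolds = * partial_string_metric[OF assms] metric_diag_eq[OF assms(2) r(1)] r_def[symmetric]
  show ?thesis
    using exhaust_4[of l]
  proof (elim disjE)
    assume "l = 1"
    then show ?thesis
      unfolding unfolds using exhaust_4[of i] exhaust_4[of j] nz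
      by (elim disjE; simp add: string_christoffel_simps; simp add: power2_eq_square power3_eq_cube)
  next
    assume "l = 2"
    then show ?thesis
      unfolding unfolds using exhaust_4[of i] exhaust_4[of j] nz
      by (elim disjE; simp add: string_christoffel_simps; simp add: power2_eq_square power3_eq_cube)
  next
    assume "l = 3"
    then show ?thesis
      unfolding unfolds using exhaust_4[of i] exhaust_4[of j] nz
      by (elim disjE; simp add: string_christoffel_simps; simp add: power2_eq_square power3_eq_cube)
  next
    assume "l = 4"
    then show ?thesis
      unfolding unfolds using exhaust_4[of i] exhaust_4[of j] nz
      by (elim disjE; simp add: string_christoffel_simps; simp add: power2_eq_square power3_eq_cube)
  qed
qed

lemma string_christoffel_has_derivative:
  assumes "rh > 0" "r > rh"
  shows "(string_christoffel rh l i j has_real_derivative string_christoffel_deriv rh l i j r) (at r)"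
proof -
  have nz: "r \<noteq> 0" "r\<^sup>2 - rh\<^sup>2 \<noteq> 0" "r * (r\<^sup>2 - rh\<^sup>2) \<noteq> 0"
    using assms lapse_pos(2)[OF assms] by auto
  have 1: "((\<lambda>r. rh\<^sup>2 / (r * (r\<^sup>2 - rh\<^sup>2))) has_real_derivative
      - rh\<^sup>2 * (3 * r\<^sup>2 - rh\<^sup>2) / (r * (r\<^sup>2 - rh\<^sup>2))\<^sup>2) (at r)"
    using nz by (auto intro!: derivative_eq_intros) (simp add: power2_eq_square algebra_simps)
  have 2: "((\<lambda>r. rh\<^sup>2 * (r\<^sup>2 - rh\<^sup>2) / r ^ 3) has_real_derivative
      rh\<^sup>2 * (3 * rh\<^sup>2 - r\<^sup>2) / r ^ 4) (at r)"
    using nz(1)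
    by (auto intro!: derivative_eq_intros) (simp add: divide_simps eval_nat_numeral, simp add: algebra_simps)
  have 3: "((\<lambda>r. - r / (r\<^sup>2 - rh\<^sup>2)) has_real_derivative
      (r\<^sup>2 + rh\<^sup>2) / (r\<^sup>2 - rh\<^sup>2)\<^sup>2) (at r)"
    using nz(2) by (auto intro!: derivative_eq_intros) (simp add: divide_simps power2_eq_square)
  show ?thesis
    unfolding string_christoffel_def[abs_def] string_christoffel_deriv_def
    using 1 2 3 by auto
qed

text \<open>The closed form of the symbols holds on the whole open region and may therefore be
  differentiated.\<close>

lemma partial_christoffel_string_metric:
  assumes "k > 0" "rh > 0" "p \<in> exterior_region rh"
  shows "partial m (christoffel (string_metric k rh) l i j) p =
    (if m = 2 then string_christoffel_deriv rh l i j (p $ 2) else 0)"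
proof -
  have "partial m (christoffel (string_metric k rh) l i j) p =
      partial m (\<lambda>q. string_christoffel rh l i j (q $ 2)) p"
    using assms by (intro partial_cong_open[OF open_exterior_region] christoffel_string_metric)
  also have "\<dots> = (if m = 2 then string_christoffel_deriv rh l i j (p $ 2) else 0)"
    using assms
    by (intro partial_component string_christoffel_has_derivative) (auto simp: exterior_region_def)
  finally show ?thesis .
qed

section \<open>Ricci tensor\<close>

text \<open>The space is a (t, r) surface times a flat plane, so the Ricci tensor is K times the
  surface metric, with Gauss curvature K = 2 k^2 rh^2 / r^2. The values are verified by expanding
  the definition.\<close>

lemma ricci_string_metric:
  assumes "k > 0" "rh > 0" "p \<in> exterior_region rh"
  defines "r \<equiv> p $ 2"
  shows "ricci (string_metric k rh) i j p =
    (if i = 1 \<and> j = 1 then - 2 * rh\<^sup>2 * (r\<^sup>2 - rh\<^sup>2) / r ^ 4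
     else if i = 2 \<and> j = 2 then 2 * rh\<^sup>2 / (r\<^sup>2 * (r\<^sup>2 - rh\<^sup>2)) else 0)"
proof -
  have r: "r > rh" "r > 0" using assms by (auto simp: exterior_region_def)
  have nz: "r \<noteq> 0" "r\<^sup>2 \<noteq> rh\<^sup>2"
    using r lapse_pos(2)[OF assms(2) r(1)] by auto
  show ?thesis
    unfolding ricci_def riemann_def partial_christoffel_string_metric[OF assms(1-3)]
      christoffel_string_metric[OF assms(1-3)] r_def[symmetric] sum_4
    using exhaust_4[of i] exhaust_4[of j] nz
    by (elim disjE)
      (simp_all add: string_christoffel_simps string_christoffel_deriv_simps,
       simp_all add: divide_simps eval_nat_numeral, simp_all add: algebra_simps)
qed

section \<open>Gradient and Hessian of the dilaton\<close>

lemma partial_dilaton: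
  assumes "k > 0" "rh > 0" "p \<in> exterior_region rh"
  shows "partial i (dilaton k \<sigma>0) p = (if i = 2 then - 2 / p $ 2 else 0)"
proof -
  have "((\<lambda>r. - 2 * ln (k * r) - \<sigma>0) has_real_derivative - 2 / p $ 2) (at (p $ 2))"
    using assms by (auto intro!: derivative_eq_intros simp: exterior_region_def field_simps)
  from partial_component[OF this] show ?thesis
    by (simp add: dilaton_def[abs_def])
qed

text \<open>With sigma' = -2/r, the tt component is (2/r) Gamma^r_tt and the rr component is 2/r^2 +
  (2/r) Gamma^r_rr. These are the negatives of the Ricci components.\<close>

lemma cov_hessian_dilaton:
  assumes "k > 0" "rh > 0" "p \<in> exterior_region rh"
  defines "r \<equiv> p $ 2"
  shows "cov_hessian (string_metric k rh) (dilaton k \<sigma>0) i j p =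
    (if i = 1 \<and> j = 1 then 2 * rh\<^sup>2 * (r\<^sup>2 - rh\<^sup>2) / r ^ 4
     else if i = 2 \<and> j = 2 then - 2 * rh\<^sup>2 / (r\<^sup>2 * (r\<^sup>2 - rh\<^sup>2)) else 0)"
proof -
  have r: "r > rh" "r > 0" using assms by (auto simp: exterior_region_def)
  \<comment> \<open>Eliminating rh^2 in favour of \<open>D\<close> turns the claim into a rational
    identity in \<open>r\<close> and \<open>D\<close>, with both nonzero.\<close>
  define D where "D = r\<^sup>2 - rh\<^sup>2"
  have D: "D \<noteq> 0" "rh\<^sup>2 = r\<^sup>2 - D" "r \<noteq> 0"
    using r lapse_pos[OF assms(2) r(1)] by (auto simp: D_def)
  have "partial i (partial j (dilaton k \<sigma>0)) p =
      partial i (\<lambda>q. if j = 2 then - 2 / q $ 2 else 0) p"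
    using assms by (intro partial_cong_open[OF open_exterior_region]) (auto simp: partial_dilaton)
  also have "\<dots> = (if i = 2 then if j = 2 then 2 / (p $ 2)\<^sup>2 else 0 else 0)"
    using r unfolding r_def
    by (intro partial_component[where F = "\<lambda>r. if j = 2 then - 2 / r else 0"])
      (auto intro!: derivative_eq_intros simp: power2_eq_square)
  finally have *: "partial i (partial j (dilaton k \<sigma>0)) p = \<dots>" .
  show ?thesis
    unfolding cov_hessian_def cov_deriv_def * christoffel_string_metric[OF assms(1-3)]
      partial_dilaton[OF assms(1-3)] r_def[symmetric] sum_4
    using exhaust_4[of i] exhaust_4[of j] D(1,3)
    by (elim disjE)
      (simp_all add: D(2) string_christoffel_def, simp_all add: divide_simps eval_nat_numeral)
qed

text \<open>Stated for arbitrary \<open>T\<close>, so that it serves the Ricci scalar, the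
  d'Alembertian and the squared gradient alike.\<close>

lemma trace_string_metric:
  assumes "k > 0" "rh > 0" "p \<in> exterior_region rh"
  defines "r \<equiv> p $ 2"
  shows "trace_metric (string_metric k rh) T p =
    k\<^sup>2 * (- (r\<^sup>2 / (r\<^sup>2 - rh\<^sup>2)) * T 1 1 p + (r\<^sup>2 - rh\<^sup>2) * T 2 2 p + T 3 3 p + T 4 4 p)"
proof -
  have r: "r > rh" "r > 0" using assms by (auto simp: exterior_region_def)
  note pos = lapse_pos[OF assms(2) r(1)]
  show ?thesis
    unfolding trace_metric_def inv_string_metric[OF assms(1-3)] r_def[symmetric]
    using r pos assms(1)
    by (simp add: sum_4 metric_diag_eq[OF assms(2) r(1)]) (simp add: algebra_simps)
qed


section \<open>Null coordinates\<close>

text \<open>Outside the horizon the argument of the logarithm in the tortoise coordinate is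
  positive, as membership in the class demands.\<close>

lemma null_coords_elementary:
  assumes "rh > 0"
  shows "elementary_on (exterior_region rh) (\<lambda>p. null_coords rh p $ a)"
proof -
  have "(p $ 2)\<^sup>2 / rh\<^sup>2 - 1 > 0" if "p \<in> exterior_region rh" for p
    using that assms by (intro lapse_pos) (auto simp: exterior_region_def)
  then have "\<forall>a. elementary_on (exterior_region rh) (\<lambda>p. null_coords rh p $ a)"
    using assms
    unfolding forall_4 null_coords_def vector_4 null_u_def null_v_def tortoise_def Let_def
    by (intro conjI elementary_on_intros) auto
  then show ?thesis ..
qed

text \<open>The exponentials determine T - r* and T + r*, hence t and r*. The logarithm then
  determines r^2, and r is positive.\<close>

lemma inj_on_null_coords:
  assumes "rh > 0"
  shows "inj_on (null_coords rh) (exterior_region rh)"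
proof (rule inj_onI)
  fix p q
  assume pq: "p \<in> exterior_region rh" "q \<in> exterior_region rh" "null_coords rh p = null_coords rh q"
  then have comp: "\<forall>i. null_coords rh p $ i = null_coords rh q $ i" by simp
  have r: "p $ 2 > rh" "q $ 2 > rh" using pq by (auto simp: exterior_region_def)
  note pos = lapse_pos(3)[OF assms r(1)] lapse_pos(3)[OF assms r(2)]
  from comp have uv: "tortoise rh (p $ 2) - rh * p $ 1 = tortoise rh (q $ 2) - rh * q $ 1"
      "rh * p $ 1 + tortoise rh (p $ 2) = rh * q $ 1 + tortoise rh (q $ 2)"
    and xy: "p $ 3 = q $ 3" "p $ 4 = q $ 4"
    using assms by (auto simp: forall_4 null_coords_def null_u_def null_v_def Let_def)
  from uv have tor: "tortoise rh (p $ 2) = tortoise rh (q $ 2)" by linarith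
  with uv assms have "p $ 1 = q $ 1" by simp
  moreover from tor have "(p $ 2)\<^sup>2 = (q $ 2)\<^sup>2"
    using assms pos by (simp add: tortoise_def)
  then have "p $ 2 = q $ 2"
    using assms r by (simp add: power2_eq_iff)
  ultimately show "p = q"
    using xy by (simp add: vec_eq_iff forall_4)
qed

text \<open>Here \<open>rh * c\<close> is the derivative of the tortoise coordinate, so that du = u
  (c dr - dt) and dv = v (c dr + dt).\<close>

lemma jacobian_null_coords:
  assumes "rh > 0" "p \<in> exterior_region rh"
  defines "r \<equiv> p $ 2"
  defines "u \<equiv> null_u rh (p $ 1) r" and "v \<equiv> null_v rh (p $ 1) r"
    and "c \<equiv> r / (r\<^sup>2 - rh\<^sup>2)"
  shows "jacobian (null_coords rh) p = vector
    [vector [- u, u * c, 0, 0],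
     vector [v, v * c, 0, 0],
     vector [0, 0, 1, 0],
     vector [0, 0, 0, 1]]"
proof -
  have r: "r > rh" "r > 0" using assms by (auto simp: exterior_region_def)
  note pos = lapse_pos[OF assms(1) r(1)]
  have nth: "((\<lambda>q. q $ j) has_derivative (\<lambda>q. q $ j)) (at p)" for j
    by (intro bounded_linear_imp_has_derivative bounded_linear_vec_nth)
  have tor: "(tortoise rh has_real_derivative rh * c) (at r)"
  proof -
    have "r\<^sup>2 / rh\<^sup>2 - 1 = (r\<^sup>2 - rh\<^sup>2) / rh\<^sup>2"
      using assms(1) by (simp add: diff_divide_distrib)
    then have "rh / 2 * (2 * r / rh\<^sup>2 / (r\<^sup>2 / rh\<^sup>2 - 1)) = rh * c"
      using assms(1) by (simp add: c_def power2_eq_square)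
    moreover have "(tortoise rh has_real_derivative rh / 2 * (2 * r / rh\<^sup>2 / (r\<^sup>2 / rh\<^sup>2 - 1))) (at r)"
      unfolding tortoise_def[abs_def] using pos assms(1)
      by (auto intro!: derivative_eq_intros) (simp add: eval_nat_numeral)
    ultimately show ?thesis by simp
  qed
  have R: "((\<lambda>q. tortoise rh (q $ 2)) has_derivative (\<lambda>h. rh * c * h $ 2)) (at p)"
    using has_derivative_compose[OF nth tor[unfolded has_field_derivative_def r_def]] .
  have U: "((\<lambda>q. null_u rh (q $ 1) (q $ 2)) has_derivative (\<lambda>h. u * (c * h $ 2 - h $ 1))) (at p)"
    unfolding null_u_def Let_def u_def r_def using assms(1)
    by (auto intro!: derivative_eq_intros nth R) (simp add: fun_eq_iff field_simps)
  have V: "((\<lambda>q. null_v rh (q $ 1) (q $ 2)) has_derivative (\<lambda>h. v * (c * h $ 2 + h $ 1))) (at p)"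
    unfolding null_v_def Let_def v_def r_def using assms(1)
    by (auto intro!: derivative_eq_intros nth R) (simp add: fun_eq_iff field_simps)
  show ?thesis
    unfolding jacobian_def null_coords_def
    by (simp add: vec_eq_iff forall_4 partial_eq_of_has_derivative[OF U]
        partial_eq_of_has_derivative[OF V] partial_eq_of_has_derivative[OF nth] axis_def)
qed

section \<open>The metric in null coordinates\<close>

lemma null_u_times_null_v:
  assumes "rh > 0" "r > rh"
  shows "null_u rh t r * null_v rh t r = rh\<^sup>2 - r\<^sup>2"
proof -
  \<comment> \<open>The time cancels in the sum of the exponents, leaving 2 r* / rh, which is the
    logarithm on the right.\<close>
  have "null_u rh t r * null_v rh t r = - rh\<^sup>2 * exp (ln (r\<^sup>2 / rh\<^sup>2 - 1))"
    using assms unfolding null_u_def null_v_def tortoise_def Let_def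
    by (simp add: power2_eq_square flip: exp_add) (simp add: field_simps)
  also have "\<dots> = rh\<^sup>2 - r\<^sup>2"
    using lapse_pos[OF assms] assms by (simp add: field_simps)
  finally show ?thesis .
qed

text \<open>With c = r / (r^2 - rh^2), du dv = u v (c^2 dr^2 - dt^2). Inserting u v = rh^2 - r^2 and
  dividing by -(rh^2 - u v) = -r^2 gives the t and r terms of the metric, up to k^-2.\<close>

lemma string_metric_eq_pullback:
  assumes "k > 0" "rh > 0" "p \<in> exterior_region rh"
  shows "string_metric k rh p = pullback_metric (null_coords rh) (witten_times_flat k rh) p"
proof -
  define r where "r = p $ 2"
  define u where "u = null_u rh (p $ 1) r"
  define v where "v = null_v rh (p $ 1) r"
  have r: "r > rh" "r > 0" using assms by (auto simp: exterior_region_def r_def)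
  note pos = lapse_pos[OF assms(2) r(1)]
  have uv: "u * v = rh\<^sup>2 - r\<^sup>2"
    unfolding u_def v_def using assms(2) r(1) by (rule null_u_times_null_v)
  have W: "witten_times_flat k rh (null_coords rh p) = vector
    [vector [0, - 1 / (k\<^sup>2 * 2 * r\<^sup>2), 0, 0],
     vector [- 1 / (k\<^sup>2 * 2 * r\<^sup>2), 0, 0, 0],
     vector [0, 0, 1 / k\<^sup>2, 0],
     vector [0, 0, 0, 1 / k\<^sup>2]]"
    using uv by (simp add: witten_times_flat_def witten_metric_def null_coords_def Let_def
        u_def v_def r_def)
  define D where "D = r\<^sup>2 - rh\<^sup>2"
  \<comment> \<open>Eliminating \<open>v\<close> leaves \<open>u\<close> as a nonzero parameter that
    drops out, so the matrix equation becomes a rational identity.\<close>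
  have u: "u \<noteq> 0"
    using assms(2) by (simp add: u_def null_u_def Let_def)
  with uv have v: "v = - D / u"
    by (simp add: D_def field_simps)
  have nz: "D \<noteq> 0" "r \<noteq> 0" "k \<noteq> 0"
    using r pos assms(1) by (auto simp: D_def)
  show ?thesis
    unfolding pullback_metric_def jacobian_null_coords[OF assms(2,3)] W string_metric_eq_diag
      r_def[symmetric] u_def[symmetric] v_def[symmetric] metric_diag_eq[OF assms(2) r(1)]
      D_def[symmetric] v
    using u nz
    by (simp add: vec_eq_iff forall_4 transpose_def matrix_matrix_mult_def sum_4)
      (simp add: divide_simps power2_eq_square)
qed

lemma det_jacobian_null_coords:
  assumes "rh > 0" "p \<in> exterior_region rh"
  shows "det (jacobian (null_coords rh) p) \<noteq> 0"
proof
  \<comment> \<open>The pulled-back metric has determinant \<open>(det J)\<^sup>2 det h\<close>.\<close>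
  assume "det (jacobian (null_coords rh) p) = 0"
  \<comment> \<open>The coordinate map does not involve \<open>k\<close>, so the metric with
    \<open>k = 1\<close> can be used.\<close>
  then have "det (string_metric 1 rh p) = 0"
    using assms by (simp add: string_metric_eq_pullback pullback_metric_def det_mul)
  moreover have "det (string_metric 1 rh p) \<noteq> 0"
    unfolding string_metric_eq_diag det_diag_matrix
    using assms metric_diag_nonzero[of 1 rh "p $ 2"] by (auto simp: exterior_region_def)
  ultimately show False by simp
qed

section \<open>Field equations and null form\<close>

theorem mainTheorem2:
  fixes k rh \<sigma>0 :: real
  assumes "k > 0" and "rh > 0"
  defines "U \<equiv> exterior_region rh"
    and "g \<equiv> string_metric k rh"
    and "\<sigma> \<equiv> dilaton k \<sigma>0"
  shows "lorentzian_metric_on U g \<and> smooth_on U \<sigma> \<and>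
    (\<forall>p\<in>U. \<forall>\<mu> \<nu>. ricci g \<mu> \<nu> p + cov_hessian g \<sigma> \<mu> \<nu> p = 0) \<and>
    (\<forall>p\<in>U. ricci_scalar g p + 2 * dalembertian g \<sigma> p - grad_sq g \<sigma> p + 4 * k\<^sup>2 = 0) \<and>
    coordinate_system_on U (null_coords rh) \<and>
    (\<forall>p\<in>U. g p = pullback_metric (null_coords rh) (witten_times_flat k rh) p)"
proof (intro conjI ballI allI)
  show "lorentzian_metric_on U g"
    unfolding U_def g_def using assms(1,2) by (rule lorentzian_string_metric)
  show "smooth_on U \<sigma>"
    unfolding U_def \<sigma>_def dilaton_def[abs_def] using assms(1,2)
    by (intro elementary_on_imp_smooth_on open_exterior_region elementary_on_intros)
      (auto simp: exterior_region_def)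
  show "coordinate_system_on U (null_coords rh)"
    unfolding coordinate_system_on_def U_def using assms(2)
    by (auto intro: elementary_on_imp_smooth_on open_exterior_region null_coords_elementary
        inj_on_null_coords simp: det_jacobian_null_coords)
next
  fix p assume "p \<in> U"
  then have p: "p \<in> exterior_region rh" and r: "p $ 2 > rh"
    by (auto simp: U_def exterior_region_def)
  note pos = lapse_pos[OF assms(2) r]
  show "g p = pullback_metric (null_coords rh) (witten_times_flat k rh) p"
    unfolding g_def using assms(1,2) p by (rule string_metric_eq_pullback)
  show "ricci g \<mu> \<nu> p + cov_hessian g \<sigma> \<mu> \<nu> p = 0" for \<mu> \<nu>
    unfolding g_def \<sigma>_def ricci_string_metric[OF assms(1,2) p]
      cov_hessian_dilaton[OF assms(1,2) p] by simp
  \<comment> \<open>The Ricci scalar is R = 4 k^2 rh^2 / r^2, the d'Alembertian of sigma is -R, and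
    the squared gradient is 4 k^2 - R, so the sum vanishes.\<close>
  show "ricci_scalar g p + 2 * dalembertian g \<sigma> p - grad_sq g \<sigma> p + 4 * k\<^sup>2 = 0"
    unfolding g_def \<sigma>_def ricci_scalar_def dalembertian_def grad_sq_def
      trace_string_metric[OF assms(1,2) p] ricci_string_metric[OF assms(1,2) p]
      cov_hessian_dilaton[OF assms(1,2) p] partial_dilaton[OF assms(1,2) p]
    using r pos assms(1,2)
    by simp (simp add: divide_simps eval_nat_numeral, simp add: algebra_simps)
qed

end
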